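(* Let $f\in\mathcal{C}$ have Taylor expansion $f(z)=z+\sum_{n=2}^{\infty}a_nz^n$ in $\mathbb{D}$. Then: (i) $|T_2(n)|\le 2$ for every $n\ge2$; (ii) $|T_3(1)|\le 4$; (iii) $|T_3(2)|\le 4$. All the inequalities are sharp, i.e. for each of them (and for each $n\ge2$ in (i)) there is a function in $\mathcal{C}$ for which equality holds.
   Context: $\mathbb{D}=\{z\in\mathbb{C}:|z|<1\}$. $\mathcal{A}$ is the class of analytic functions $f$ in $\mathbb{D}$ with Taylor series $f(z)=z+\sum_{n=2}^\infty a_nz^n$, and $\mathcal{S}$ is the subclass of univalent functions in $\mathcal{A}$. $\mathcal{C}$ is the class of convex functions in $\mathcal{S}$, i.e. those for which $f(\mathbb{D})$ is a convex domain; equivalently, $f\in\mathcal{A}$ and $\operatorname{Re}\left(1+\frac{zf''(z)}{f'(z)}\right)>0$ in $\mathbb{D}$. With $a_1=1$, the symmetric Toeplitz determinant $T_q(n)$ of $f$ ($n,q\ge1$) is the determinant of the $q\times q$ matrix whose $(i,j)$ entry is $a_{n+|i-j|}$. Thus $T_2(n)=a_n^2-a_{n+1}^2$, $T_3(1)=\det\begin{pmatrix} 1 & a_2 & a_3 \\ a_2 & 1 & a_2 \\ a_3 & a_2 & 1 \end{pmatrix}$ and $T_3(2)=\det\begin{pmatrix} a_2 & a_3 & a_4 \\ a_3 & a_2 & a_3 \\ a_4 & a_3 & a_2 \end{pmatrix}$. *)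

theory Defs
  imports "HOL-Complex_Analysis.Complex_Analysis" "Jordan_Normal_Form.Determinant"
begin

definition taylor_coeff :: "(complex \<Rightarrow> complex) \<Rightarrow> nat \<Rightarrow> complex" where
  "taylor_coeff f n = fps_nth (fps_expansion f 0) n"

definition class_A :: "(complex \<Rightarrow> complex) set" where
  "class_A = {f. f holomorphic_on ball 0 1 \<and> taylor_coeff f 0 = 0 \<and> taylor_coeff f 1 = 1}"

definition class_S :: "(complex \<Rightarrow> complex) set" where
  "class_S = {f \<in> class_A. inj_on f (ball 0 1)}"

text \<open>The image of a univalent function is automatically a domain, by the open mapping theorem.\<close>
definition class_C :: "(complex \<Rightarrow> complex) set" where
  "class_C = {f \<in> class_S. convex (f ` ball 0 1)}"

definition toeplitz_det :: "nat \<Rightarrow> nat \<Rightarrow> (complex \<Rightarrow> complex) \<Rightarrow> complex" where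
  "toeplitz_det q n f =
     Determinant.det (mat q q (\<lambda>(i, j). taylor_coeff f (n + nat \<bar>int i - int j\<bar>)))"

end

theory Submission imports Defs begin

text \<open>
  For a convex function \<open>f\<close> and real \<open>t\<close>, the midpoint of \<open>f (e\<^sup>i\<^sup>t z)\<close> and \<open>f (e\<^sup>-\<^sup>i\<^sup>t z)\<close>
  lies in the image of \<open>f\<close>, so its preimage \<open>w\<^sub>t z\<close> satisfies \<open>\<bar>w\<^sub>t z\<bar> \<le> \<bar>z\<bar>\<close> by the Schwarz
  lemma. Expanding to second order at \<open>t = 0\<close> shows that \<open>p z = 1 + z f'' z / f' z\<close> has
  nonnegative real part. Writing the coefficients \<open>p\<^sub>n\<close> of \<open>p\<close> as moments of \<open>Re p\<close> on circles
  gives \<open>\<bar>p\<^sub>n\<bar> \<le> 2\<close> and Livingston's inequality \<open>\<bar>p\<^sub>n\<^sub>+\<^sub>k - p\<^sub>n p\<^sub>k\<bar> \<le> 2\<close>. Comparing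
  coefficients in \<open>(z f')' = p f'\<close> yields \<open>\<bar>a\<^sub>n\<bar> \<le> 1\<close>, \<open>\<bar>a\<^sub>3 - 2 a\<^sub>2\<^sup>2\<bar> \<le> 1\<close> and
  \<open>\<bar>a\<^sub>2 a\<^sub>4 - 2 a\<^sub>3\<^sup>2\<bar> \<le> 1\<close>; the third-order determinants factor as
  \<open>T\<^sub>3(n) = (a\<^sub>n - a\<^sub>n\<^sub>+\<^sub>2) (a\<^sub>n\<^sup>2 + a\<^sub>n a\<^sub>n\<^sub>+\<^sub>2 - 2 a\<^sub>n\<^sub>+\<^sub>1\<^sup>2)\<close>. Equality holds for the half-plane
  map \<open>z / (1 - i z)\<close>.
\<close>

section \<open>From convexity of the image to nonnegative real part of 1 + z f'' / f'\<close>

lemma second_symmetric_difference_quotient: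
  fixes F :: "complex \<Rightarrow> complex"
  assumes "open A" "0 \<in> A" "F holomorphic_on A"
  shows "((\<lambda>x. (F x + F (-x) - 2 * F 0) / x\<^sup>2) \<longlongrightarrow> (deriv ^^ 2) F 0) (at 0)"
proof -
  define P where "P = fps_expansion F 0"
  \<comment> \<open>In \<open>Q\<close> the odd coefficients of \<open>P\<close> cancel, the
    constant term is removed and the even ones double, so \<open>Q\<close> starts at x^2 with
    coefficient \<open>(deriv ^^ 2) F 0\<close>.\<close>
  define Q where "Q = P + (P oo (- fps_X)) - fps_const (2 * F 0)"
  have P: "F has_fps_expansion P"
    unfolding P_def using assms by (rule has_fps_expansion_fps_expansion)
  have "(F \<circ> (\<lambda>x. -x)) has_fps_expansion (P oo (- fps_X))"
    by (intro has_fps_expansion_compose P has_fps_expansion_minus has_fps_expansion_fps_X) auto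
  hence Q: "(\<lambda>x. F x + F (-x) - 2 * F 0) has_fps_expansion Q"
    unfolding Q_def comp_def by (intro has_fps_expansion_diff has_fps_expansion_add P) auto
  have P0: "fps_nth P 0 = F 0" and P2: "fps_nth P 2 = (deriv ^^ 2) F 0 / 2"
    using fps_nth_fps_expansion[OF P, of 0] fps_nth_fps_expansion[OF P, of 2] by auto
  have Q0: "fps_nth Q 0 = 0" "fps_nth Q 1 = 0" and Q2: "fps_nth Q 2 = (deriv ^^ 2) F 0"
    by (simp_all add: Q_def fps_compose_uminus' P0 P2)
  show ?thesis
  \<comment> \<open>The zero series has subdegree 0 by convention, so a factor x^2 can be split off
    via \<open>subdegree\<close> only when \<open>Q\<close> is nonzero; otherwise the quotient
    vanishes near 0.\<close>
  proof (cases "Q = 0")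
    case True
    hence "(\<lambda>x. F x + F (-x) - 2 * F 0) has_fps_expansion 0"
      using Q by simp
    hence "eventually (\<lambda>x. F x + F (-x) - 2 * F 0 = 0) (nhds 0)"
      by (auto simp: has_fps_expansion_def elim: eventually_mono)
    hence "eventually (\<lambda>x. (F x + F (-x) - 2 * F 0) / x\<^sup>2 = 0) (at 0)"
      by (intro eventually_nhds_conv_at[THEN iffD1, THEN conjunct1])
         (auto elim: eventually_mono)
    thus ?thesis using Q2 True by (simp add: tendsto_eventually)
  next
    case False
    have "2 \<le> subdegree Q"
    proof (rule subdegree_geI[OF False])
      fix i :: nat assume "i < 2"
      thus "fps_nth Q i = 0" using Q0 by (cases "i = 0") (auto simp: less_2_cases_iff)
    qed
    from has_fps_expansion_imp_continuous[OF has_fps_expansion_shift[OF Q this refl]]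
    have "isCont (\<lambda>x. if x = 0 then fps_nth Q 2 else (F x + F (-x) - 2 * F 0) / x\<^sup>2) 0"
      by blast
    hence "((\<lambda>x. if x = 0 then fps_nth Q 2 else (F x + F (-x) - 2 * F 0) / x\<^sup>2)
              \<longlongrightarrow> fps_nth Q 2) (at 0)"
      by (simp add: isCont_def)
    thus ?thesis
      unfolding Q2 by (rule Lim_transform_eventually) (auto simp: eventually_at_filter)
  qed
qed

text \<open>The angle \<open>t\<close> is taken complex so that the curve is holomorphic near 0 and
  the preceding limit applies; each differentiation in \<open>t\<close> brings out a factor i e^(it)
  z.\<close>

lemma second_deriv_along_circle:
  assumes f: "f holomorphic_on ball 0 1" and z: "z \<in> ball 0 1"
  obtains A where "open A" "0 \<in> A" "(\<lambda>t. f (exp (\<i> * t) * z)) holomorphic_on A"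
    "(deriv ^^ 2) (\<lambda>t. f (exp (\<i> * t) * z)) 0 = - (z * deriv f z + z\<^sup>2 * deriv (deriv f) z)"
proof
  define A where "A = (\<lambda>t. exp (\<i> * t) * z) -` ball 0 1"
  show A: "open A" unfolding A_def
    by (intro open_vimage continuous_intros) auto
  show 0: "0 \<in> A" using z by (simp add: A_def)
  have f': "deriv f holomorphic_on ball 0 1"
    by (intro holomorphic_deriv f) auto
  have comp: "((\<lambda>t. h (exp (\<i> * t) * z)) has_field_derivative
           deriv h (exp (\<i> * t) * z) * (\<i> * exp (\<i> * t) * z)) (at t)"
    if "h holomorphic_on ball 0 1" "t \<in> A" for h t
  proof (rule DERIV_chain2[where f = h])
    show "(h has_field_derivative deriv h (exp (\<i> * t) * z)) (at (exp (\<i> * t) * z))"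
      using that by (intro holomorphic_derivI[of h "ball 0 1"]) (auto simp: A_def)
    show "((\<lambda>t. exp (\<i> * t) * z) has_field_derivative \<i> * exp (\<i> * t) * z) (at t)"
      by (auto intro!: derivative_eq_intros)
  qed
  show "(\<lambda>t. f (exp (\<i> * t) * z)) holomorphic_on A"
    using comp[OF f] A by (auto simp: holomorphic_on_open)
  have "eventually (\<lambda>t. t \<in> A) (nhds 0)"
    using A 0 by (rule eventually_nhds_in_open)
  hence "eventually (\<lambda>t. deriv (\<lambda>t. f (exp (\<i> * t) * z)) t =
           deriv f (exp (\<i> * t) * z) * (\<i> * exp (\<i> * t) * z)) (nhds 0)"
    by eventually_elim (intro DERIV_imp_deriv comp f)
  hence "deriv (deriv (\<lambda>t. f (exp (\<i> * t) * z))) 0 =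
           deriv (\<lambda>t. deriv f (exp (\<i> * t) * z) * (\<i> * exp (\<i> * t) * z)) 0"
    by (intro deriv_cong_ev refl)
  also have "\<dots> = - (z * deriv f z + z\<^sup>2 * deriv (deriv f) z)"
    by (rule DERIV_imp_deriv)
       (use comp[OF f' 0] in \<open>auto intro!: derivative_eq_intros simp: power2_eq_square algebra_simps\<close>)
  finally show "(deriv ^^ 2) (\<lambda>t. f (exp (\<i> * t) * z)) 0 = - (z * deriv f z + z\<^sup>2 * deriv (deriv f) z)"
    by (simp add: numeral_2_eq_2)
qed

text \<open>Let \<open>g\<close> invert \<open>f\<close>, let \<open>U t\<close> be the midpoint of
  f(e^(it) z) and f(e^(-it) z), and let c be the quantity in question. Then g(U t) / z = 1 - c t^2 /
  2 + o(t^2), while its modulus is at most 1 for real t; hence Re c cannot be negative.\<close>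

lemma Re_convexity_quotient_nonneg:
  assumes hol: "f holomorphic_on ball 0 1" and inj: "inj_on f (ball 0 1)"
    and conv: "convex (f ` ball 0 1)" and z: "z \<in> ball 0 1"
  shows "Re (1 + z * deriv (deriv f) z / deriv f z) \<ge> 0"
proof (cases "z = 0")
  case False
  obtain g where g: "g holomorphic_on f ` ball 0 1"
    and g': "\<And>z. z \<in> ball 0 1 \<Longrightarrow> deriv f z * deriv g (f z) = 1"
    and gf: "\<And>z. z \<in> ball 0 1 \<Longrightarrow> g (f z) = z"
    using holomorphic_has_inverse[OF hol open_ball inj] by metis
  have op: "open (f ` ball 0 1)"
    by (rule open_mapping_thm3[OF hol open_ball inj])
  have nz: "deriv f z \<noteq> 0" using g'[OF z] by auto
  define F where "F = (\<lambda>t. f (exp (\<i> * t) * z))"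
  define L where "L = - (z * deriv f z + z\<^sup>2 * deriv (deriv f) z)"
  obtain A where A: "open A" "0 \<in> A" "F holomorphic_on A" "(deriv ^^ 2) F 0 = L"
    using second_deriv_along_circle[OF hol z] unfolding F_def L_def by metis
  define U where "U = (\<lambda>t. (F t + F (-t)) / 2)"
  have "((\<lambda>x. (F x + F (-x) - 2 * F 0) / x\<^sup>2 / 2) \<longlongrightarrow> L / 2) (at 0)"
    using second_symmetric_difference_quotient[OF A(1-3)] unfolding A(4)
    by (rule tendsto_divide) auto
  hence U: "((\<lambda>x. (U x - f z) / x\<^sup>2) \<longlongrightarrow> L / 2) (at 0)"
    by (simp add: U_def F_def field_simps)
  have "isCont F 0"
    using A by (meson continuous_on_eq_continuous_at holomorphic_on_imp_continuous_on)
  hence "isCont U 0" unfolding U_def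
    by (intro continuous_intros isCont_o2[of _ uminus]) auto
  moreover have "U 0 = f z" by (simp add: U_def F_def)
  ultimately have Ulim: "(U \<longlongrightarrow> f z) (at 0)" by (simp add: isCont_def)
  \<comment> \<open>The difference quotient of \<open>g\<close> is replaced by a function
    \<open>d\<close> continuous at \<open>f z\<close>, which avoids dividing by
    \<open>U t - f z\<close>, a quantity that may vanish.\<close>
  have "(g has_field_derivative deriv g (f z)) (at (f z))"
    using g op z by (intro holomorphic_derivI) auto
  then obtain d where d: "\<And>w. g w - g (f z) = d w * (w - f z)" "isCont d (f z)"
    "d (f z) = deriv g (f z)"
    unfolding CARAT_DERIV by blast
  have "((\<lambda>t. d (U t) * ((U t - f z) / t\<^sup>2)) \<longlongrightarrow> deriv g (f z) * (L / 2)) (at 0)"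
    using d(2,3) by (intro tendsto_mult U isCont_tendsto_compose[OF _ Ulim, of d, unfolded d(3)])
  hence "((\<lambda>t. (g (U t) - z) / t\<^sup>2) \<longlongrightarrow> deriv g (f z) * (L / 2)) (at 0)"
    using d(1) gf[OF z] by simp
  moreover have "deriv g (f z) = 1 / deriv f z"
    using g'[OF z] nz by (simp add: field_simps)
  moreover have "L = - z * deriv f z * (1 + z * deriv (deriv f) z / deriv f z)"
    using nz by (simp add: L_def field_simps power2_eq_square)
  ultimately have "((\<lambda>t. (g (U t) - z) / t\<^sup>2) \<longlongrightarrow> - z * (1 + z * deriv (deriv f) z / deriv f z) / 2) (at 0)"
    using nz by simp
  hence "((\<lambda>t. (- 2 / z) * ((g (U t) - z) / t\<^sup>2)) \<longlongrightarrow>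
            (- 2 / z) * (- z * (1 + z * deriv (deriv f) z / deriv f z) / 2)) (at 0)"
    by (rule tendsto_mult_left)
  moreover have "(- 2 / z) * (- z * c / 2) = c" "(- 2 / z) * ((w - z) / v) = 2 * (1 - w / z) / v"
    for c w v using False by (simp_all add: divide_simps)
  ultimately have lim: "((\<lambda>t. 2 * (1 - g (U t) / z) / t\<^sup>2) \<longlongrightarrow>
      1 + z * deriv (deriv f) z / deriv f z) (at 0)"
    by (simp only:)
  \<comment> \<open>For real t both e and its inverse are unimodular, so \<open>h\<close> is a
    holomorphic self-map of the disc fixing 0, and the Schwarz lemma applies to it at
    \<open>z\<close>.\<close>
  have bound: "cmod (g (U (of_real t))) \<le> cmod z" for t :: real
  proof -
    define e where "e = exp (\<i> * of_real t)"
    have e: "cmod e = 1" "cmod (inverse e) = 1" by (simp_all add: e_def norm_inverse)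
    define h where "h = (\<lambda>y. g ((f (e * y) + f (inverse e * y)) / 2))"
    have mid: "(f (e * y) + f (inverse e * y)) / 2 \<in> f ` ball 0 1" if "y \<in> ball 0 1" for y
    proof -
      have "f (e * y) \<in> f ` ball 0 1" "f (inverse e * y) \<in> f ` ball 0 1"
        using that e by (auto simp: norm_mult intro!: imageI)
      from convexD[OF conv this, of "1/2" "1/2"] show ?thesis
        by (simp add: scaleR_conv_of_real field_simps)
    qed
    have rot: "(\<lambda>y. f (c * y)) holomorphic_on ball 0 1" if "cmod c = 1" for c
    proof -
      have "(f \<circ> (\<lambda>y. c * y)) holomorphic_on ball 0 1"
        by (rule holomorphic_on_compose_gen[OF _ hol]) (auto intro!: holomorphic_intros simp: norm_mult that)
      thus ?thesis by (simp add: o_def)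
    qed
    have "(g \<circ> (\<lambda>y. (f (e * y) + f (inverse e * y)) / 2)) holomorphic_on ball 0 1"
      using mid by (intro holomorphic_on_compose_gen[OF _ g] holomorphic_intros rot e) auto
    hence "h holomorphic_on ball 0 1" by (simp add: h_def o_def)
    moreover have "h 0 = 0" using gf[of 0] by (simp add: h_def)
    moreover have "cmod (h y) < 1" if "cmod y < 1" for y
      using mid[of y] that gf unfolding h_def by force
    ultimately have "cmod (h z) \<le> cmod z"
      using z by (intro Schwarz_Lemma(1)) auto
    thus ?thesis by (simp add: h_def U_def F_def e_def exp_minus)
  qed
  \<comment> \<open>The limit was taken over complex t but the modulus bound holds for real t, so 0
    is approached along the positive reals.\<close>
  have "filterlim (complex_of_real) (at 0) (at_right 0)"
    unfolding filterlim_at by (auto intro!: tendsto_eq_intros simp: eventually_at_filter)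
  from tendsto_Re[OF filterlim_compose[OF lim this]]
  have "((\<lambda>t. Re (2 * (1 - g (U (of_real t)) / z) / (of_real t)\<^sup>2)) \<longlongrightarrow>
          Re (1 + z * deriv (deriv f) z / deriv f z)) (at_right 0)" .
  moreover have "Re (2 * (1 - g (U (of_real t)) / z) / (of_real t)\<^sup>2) \<ge> 0" for t
  proof -
    have "Re (g (U (of_real t)) / z) \<le> 1"
      using complex_Re_le_cmod[of "g (U (of_real t)) / z"] bound[of t] False
      by (simp add: norm_divide divide_le_eq_1 order_trans)
    moreover have "2 * (1 - g (U (of_real t)) / z) / (of_real t)\<^sup>2 =
        (2 / t\<^sup>2) *\<^sub>R (1 - g (U (of_real t)) / z)"
      by (simp add: scaleR_conv_of_real)
    ultimately show ?thesis by simp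
  qed
  ultimately show ?thesis
    by (intro tendsto_lowerbound[where F = "at_right 0"]) (auto intro: always_eventually)
qed simp

section \<open>Caratheodory and Livingston inequalities through moments of a probability
  density\<close>

context
  fixes g :: "real \<Rightarrow> real" and e :: "real \<Rightarrow> complex" and c :: "nat \<Rightarrow> complex"
  assumes g: "continuous_on {0..1} g" "\<And>x. x \<in> {0..1} \<Longrightarrow> g x \<ge> 0" "(g has_integral 1) {0..1}"
    and e: "continuous_on {0..1} e" "\<And>x. x \<in> {0..1} \<Longrightarrow> cmod (e x) = 1"
    and c: "\<And>n. ((\<lambda>x. of_real (g x) * e x ^ n) has_integral c n) {0..1}"
begin

lemma norm_unimodular_moment_le: "cmod (c n) \<le> 1"
proof -
  have "cmod (integral {0..1} (\<lambda>x. of_real (g x) * e x ^ n)) \<le> integral {0..1} g"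
    using g e c by (intro Henstock_Kurzweil_Integration.integral_norm_bound_integral)
      (auto simp: norm_mult norm_power intro: has_integral_integrable)
  thus ?thesis using c[of n] g(3) by (simp add: integral_unique)
qed

text \<open>The expression is the mean of e^n w with w = e^k - 2 c_k under the density
  \<open>g\<close>, and the mean of |w|^2 is 1 + 4 |c_k|^2 - 4 |c_k|^2 = 1. The majorant
  \<open>?G\<close> is g (1 + |w|^2) / 2 with |w|^2 expanded by |e| = 1.\<close>

lemma norm_unimodular_moment_diff_le: "cmod (c (n + k) - 2 * c n * c k) \<le> 1"
proof -
  let ?F = "\<lambda>x. of_real (g x) * e x ^ (n + k) - 2 * c k * (of_real (g x) * e x ^ n)"
  let ?G = "\<lambda>x. (1 + 2 * (cmod (c k))\<^sup>2) * g x - 2 * Re (cnj (c k) * (of_real (g x) * e x ^ k))"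
  have F: "(?F has_integral c (n + k) - 2 * c k * c n) {0..1}"
    by (intro has_integral_diff has_integral_mult_right c)
  have "(?G has_integral (1 + 2 * (cmod (c k))\<^sup>2) * 1 - 2 * Re (cnj (c k) * c k)) {0..1}"
    by (intro has_integral_diff has_integral_mult_right has_integral_Re c g)
  moreover have "Re (cnj (c k) * c k) = (cmod (c k))\<^sup>2"
    unfolding cmod_power2 by (simp add: power2_eq_square)
  ultimately have G: "(?G has_integral 1) {0..1}" by (simp only:) simp
  have "cmod (?F x) \<le> ?G x" if x: "x \<in> {0..1}" for x
  proof -
    define w where "w = e x ^ k - 2 * c k"
    \<comment> \<open>AM-GM in place of the Cauchy-Schwarz inequality: the weighted mean of \<open>\<bar>w\<bar>\<^sup>2\<close> is 1.\<close>
    have "2 * cmod w \<le> 1 + (cmod w)\<^sup>2"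
      using zero_le_power2[of "cmod w - 1"] by (simp add: power2_eq_square algebra_simps)
    also have "(cmod w)\<^sup>2 = (cmod (e x ^ k))\<^sup>2 + 4 * (cmod (c k))\<^sup>2 - 4 * Re (cnj (c k) * e x ^ k)"
      unfolding w_def cmod_power2 by (simp add: power2_eq_square algebra_simps)
    also have "cmod (e x ^ k) = 1" using e x by (simp add: norm_power)
    finally have "g x * (2 * cmod w) \<le> g x * (1 + (1\<^sup>2 + 4 * (cmod (c k))\<^sup>2 - 4 * Re (cnj (c k) * e x ^ k)))"
      using g(2)[OF x] by (rule mult_left_mono)
    moreover have "?F x = of_real (g x) * e x ^ n * w"
      by (simp add: w_def algebra_simps power_add)
    hence "cmod (?F x) = g x * cmod w"
      using g(2)[OF x] e x by (simp add: norm_mult norm_power)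
    moreover have "Re (cnj (c k) * (of_real (g x) * e x ^ k)) = g x * Re (cnj (c k) * e x ^ k)"
      by (simp add: algebra_simps)
    ultimately show ?thesis by (simp only:) (simp add: algebra_simps)
  qed
  hence "cmod (integral {0..1} ?F) \<le> integral {0..1} ?G"
    using F G by (intro Henstock_Kurzweil_Integration.integral_norm_bound_integral) auto
  thus ?thesis using F G by (simp add: integral_unique mult_ac)
qed

end

text \<open>On the circle dw = 2 pi i w dx, so contour integrals become means over [0,1]. The first
  mean is Cauchy's formula for derivatives; the second is Cauchy's theorem for p(w) w^(n-1).\<close>

lemma circle_mean_holomorphic:
  assumes p: "p holomorphic_on ball 0 1" and r: "0 < r" "r < 1"
  defines "u \<equiv> circlepath 0 r"
  shows "((\<lambda>x. p (u x) / u x ^ n) has_integral (deriv ^^ n) p 0 / fact n) {0..1}"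
    and "n > 0 \<Longrightarrow> ((\<lambda>x. p (u x) * u x ^ n) has_integral 0) {0..1}"
proof -
  have u: "u x \<noteq> 0" for x using r by (simp add: u_def circlepath)
  have du: "vector_derivative u (at x within {0..1}) = 2 * pi * \<i> * u x" if "x \<in> {0..1}" for x
    using that unfolding u_def by (subst vector_derivative_circlepath01) (simp_all add: circlepath)
  have *: "((\<lambda>x. h (u x) * u x) has_integral J / (2 * pi * \<i>)) {0..1}"
    if "(h has_contour_integral J) u" for h J
  proof -
    have "((\<lambda>x. h (u x) * (2 * pi * \<i> * u x)) has_integral J) {0..1}"
      using that unfolding has_contour_integral_def
      by (rule has_integral_cong[THEN iffD1, rotated]) (simp add: du)
    from has_integral_divide[OF this, of "2 * pi * \<i>"] show ?thesis by (simp add: field_simps)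
  qed
  have "((\<lambda>w. p w / (w - 0) ^ Suc n) has_contour_integral 2 * pi * \<i> / fact n * (deriv ^^ n) p 0) u"
    unfolding u_def using r
    by (intro Cauchy_has_contour_integral_higher_derivative_circlepath
          holomorphic_on_imp_continuous_on holomorphic_on_subset[OF p]) auto
  from *[OF this] show "((\<lambda>x. p (u x) / u x ^ n) has_integral (deriv ^^ n) p 0 / fact n) {0..1}"
    using u by simp
  show "((\<lambda>x. p (u x) * u x ^ n) has_integral 0) {0..1}" if "n > 0"
  proof -
    have "((\<lambda>w. p w * w ^ (n - 1)) has_contour_integral 0) u"
      unfolding u_def using r
      by (intro Cauchy_theorem_convex_simple[where S = "ball 0 1"] holomorphic_intros p) auto
    from *[OF this] show ?thesis
      using that by (simp add: mult.assoc power_Suc2[symmetric] del: power_Suc)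
  qed
qed

text \<open>On the circle of radius r < 1 the function Re p is a probability density because p(0) =
  1. Its moments against powers of the unimodular r/u are r^m P_m / 2 for m > 0, so the moment
  inequalities apply, and r tends to 1 at the end.\<close>

lemma Caratheodory_coeff_bounds:
  assumes p: "p holomorphic_on ball 0 1" and p0: "p 0 = 1"
    and Re: "\<And>z. z \<in> ball 0 1 \<Longrightarrow> Re (p z) \<ge> 0"
    and P: "\<And>n. P n = (deriv ^^ n) p 0 / fact n"
    and nk: "n > 0" "k > 0"
  shows "cmod (P n) \<le> 2" and "cmod (P (n + k) - P n * P k) \<le> 2"
proof -
  have bounds: "r ^ n * cmod (P n) \<le> 2 \<and> r ^ (n + k) * cmod (P (n + k) - P n * P k) \<le> 2"
    if r: "0 < r" "r < 1" for r :: real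
  proof -
    define u where "u = circlepath 0 r"
    define g where "g = (\<lambda>x. Re (p (u x)))"
    define e where "e = (\<lambda>x. of_real r / u x)"
    \<comment> \<open>The moment of order 0 is 1 and not P_0 / 2: in Re p = (p + conj p) / 2 the
      conjugate half has mean zero only against positive powers.\<close>
    define c where "c = (\<lambda>n. if n = 0 then 1 else of_real r ^ n * P n / 2)"
    have u: "u x \<noteq> 0" "cmod (u x) = r" for x using r by (auto simp: u_def circlepath norm_mult)
    have ucont: "continuous_on {0..1} u" by (auto simp: u_def circlepath intro!: continuous_intros)
    have pcont: "continuous_on {0..1} (\<lambda>x. p (u x))"
      by (rule continuous_on_compose2[OF holomorphic_on_imp_continuous_on[OF p] ucont]) (use u r in auto)
    have "((\<lambda>x. p (u x)) has_integral 1) {0..1}"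
      using circle_mean_holomorphic(1)[OF p r, of 0] p0 by (simp add: u_def)
    from has_integral_Re[OF this] have g1: "(g has_integral 1) {0..1}" by (simp add: g_def)
    have c: "((\<lambda>x. of_real (g x) * e x ^ m) has_integral c m) {0..1}" for m
    proof (cases "m = 0")
      case True
      thus ?thesis using has_integral_of_real[OF g1] by (simp add: c_def)
    next
      case False
      have "((\<lambda>x. of_real r ^ m * (p (u x) / u x ^ m)) has_integral of_real r ^ m * P m) {0..1}"
        unfolding u_def P by (intro has_integral_mult_right circle_mean_holomorphic(1) p r)
      moreover have "((\<lambda>x. p (u x) * u x ^ m) has_integral 0) {0..1}"
        unfolding u_def using False by (intro circle_mean_holomorphic(2) p r) auto
      hence "((cnj \<circ> (\<lambda>x. p (u x) * u x ^ m)) has_integral cnj 0) {0..1}"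
        by (simp only: has_integral_cnj)
      hence "((\<lambda>x. inverse (of_real r ^ m) * (cnj \<circ> (\<lambda>x. p (u x) * u x ^ m)) x)
               has_integral inverse (of_real r ^ m) * cnj 0) {0..1}"
        by (intro has_integral_mult_right)
      ultimately have "((\<lambda>x. (of_real r ^ m * (p (u x) / u x ^ m) +
          inverse (of_real r ^ m) * (cnj \<circ> (\<lambda>x. p (u x) * u x ^ m)) x) / 2) has_integral
          (of_real r ^ m * P m + inverse (of_real r ^ m) * cnj 0) / 2) {0..1}"
        by (intro has_integral_divide has_integral_add)
      \<comment> \<open>Both halves carry the same factor, since conj(u) / r = r / u on the
        circle.\<close>
      moreover have "(of_real r ^ m * (p (u x) / u x ^ m) +
          inverse (of_real r ^ m) * (cnj \<circ> (\<lambda>x. p (u x) * u x ^ m)) x) / 2 =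
          of_real (g x) * e x ^ m" for x
      proof -
        have "u x * cnj (u x) = of_real r * of_real r"
          using u(2)[of x] by (simp add: complex_norm_square[symmetric] power2_eq_square)
        hence "inverse (of_real r) * cnj (u x) = e x"
          using r u(1)[of x] by (simp add: e_def field_simps)
        hence "inverse (of_real r ^ m) * cnj (u x) ^ m = e x ^ m"
          by (metis power_inverse power_mult_distrib)
        moreover have "of_real r ^ m / u x ^ m = e x ^ m" by (simp add: e_def power_divide)
        moreover have "of_real (g x) = (p (u x) + cnj (p (u x))) / 2"
          by (simp add: g_def complex_add_cnj)
        ultimately show ?thesis
          by (simp add: algebra_simps add_divide_distrib) (metis (no_types) mult.left_commute times_divide_eq_right)
      qed
      ultimately show ?thesis using False by (simp add: c_def)
    qed
    have gc: "continuous_on {0..1} g" unfolding g_def by (intro continuous_intros pcont)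
    have g0: "g x \<ge> 0" for x unfolding g_def using u r by (intro Re) auto
    have ec: "continuous_on {0..1} e" unfolding e_def by (intro continuous_intros ucont) (use u in auto)
    have e1: "cmod (e x) = 1" for x using u r by (simp add: e_def norm_divide)
    have "cmod (c n) \<le> 1"
      by (rule norm_unimodular_moment_le[OF gc g0 g1 ec e1 c])
    moreover have "cmod (c (n + k) - 2 * c n * c k) \<le> 1"
      by (rule norm_unimodular_moment_diff_le[OF gc g0 g1 ec e1 c])
    moreover have "c (n + k) - 2 * c n * c k = of_real (r ^ (n + k) / 2) * (P (n + k) - P n * P k)"
      using nk by (simp add: c_def power_add algebra_simps)
    hence "cmod (c (n + k) - 2 * c n * c k) = r ^ (n + k) / 2 * cmod (P (n + k) - P n * P k)"
      using r by (simp only: norm_mult norm_of_real) simp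
    ultimately show ?thesis
      using nk r by (simp add: c_def norm_mult norm_divide norm_power)
  qed
  have lim: "y \<le> 2" if "\<And>r. 0 < r \<Longrightarrow> r < 1 \<Longrightarrow> r ^ m * y \<le> 2" for y :: real and m
  proof (rule tendsto_upperbound[where F = "at_left 1"])
    show "((\<lambda>r. r ^ m * y) \<longlongrightarrow> y) (at_left 1)"
      by (auto intro!: tendsto_eq_intros)
    show "eventually (\<lambda>r. r ^ m * y \<le> 2) (at_left 1)"
      using eventually_at_left_real[of 0 1] by (auto elim!: eventually_mono intro: that)
  qed auto
  show "cmod (P n) \<le> 2" "cmod (P (n + k) - P n * P k) \<le> 2"
    using bounds lim by blast+
qed

section \<open>Coefficient estimates for convex functions\<close>

lemma class_C_Caratheodory_coeffs:
  assumes "f \<in> class_C"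
  obtains P where "\<And>n. (of_nat n)\<^sup>2 * taylor_coeff f n =
      (\<Sum>i<n. P i * (of_nat (n - i) * taylor_coeff f (n - i)))"
    and "P 0 = 1" "\<And>n. n > 0 \<Longrightarrow> cmod (P n) \<le> 2"
    and "\<And>n k. n > 0 \<Longrightarrow> k > 0 \<Longrightarrow> cmod (P (n + k) - P n * P k) \<le> 2"
proof -
  have hol: "f holomorphic_on ball 0 1" and inj: "inj_on f (ball 0 1)"
    and conv: "convex (f ` ball 0 1)"
    using assms by (auto simp: class_C_def class_S_def class_A_def)
  have nz: "deriv f z \<noteq> 0" if "z \<in> ball 0 1" for z
    using hol inj that by (intro holomorphic_injective_imp_regular) auto
  define p where "p = (\<lambda>z. 1 + z * deriv (deriv f) z / deriv f z)"
  define F where "F = fps_expansion f 0"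
  define Q where "Q = fps_expansion p 0"
  have p: "p holomorphic_on ball 0 1"
    unfolding p_def using nz by (intro holomorphic_intros hol) auto
  have F: "f has_fps_expansion F" and Q: "p has_fps_expansion Q"
    using hol p unfolding F_def Q_def by (auto intro!: has_fps_expansion_fps_expansion[of "ball 0 1"])
  have "(\<lambda>z. z * deriv (deriv f) z + deriv f z) has_fps_expansion
          fps_X * fps_deriv (fps_deriv F) + fps_deriv F"
    by (intro fps_expansion_intros F)
  moreover have ev: "eventually (\<lambda>z. z * deriv (deriv f) z + deriv f z = p z * deriv f z) (nhds 0)"
    by (rule eventually_mono[OF eventually_nhds_in_open[of "ball 0 1"]])
       (use nz in \<open>auto simp: p_def field_simps\<close>)
  ultimately have "(\<lambda>z. p z * deriv f z) has_fps_expansion fps_X * fps_deriv (fps_deriv F) + fps_deriv F"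
    using has_fps_expansion_cong[OF ev refl] by simp
  moreover have "(\<lambda>z. p z * deriv f z) has_fps_expansion Q * fps_deriv F"
    by (intro fps_expansion_intros F Q)
  ultimately have ode: "fps_X * fps_deriv (fps_deriv F) + fps_deriv F = Q * fps_deriv F"
    by (rule fps_expansion_unique_complex)
  \<comment> \<open>The coefficient of z^(n-1) in (z f')' is n^2 a_n, hence the shift to m = n - 1;
    for n = 0 both sides are zero.\<close>
  have rec: "(of_nat n)\<^sup>2 * fps_nth F n = (\<Sum>i<n. fps_nth Q i * (of_nat (n - i) * fps_nth F (n - i)))" for n
  proof (cases n)
    case (Suc m)
    have "(of_nat n)\<^sup>2 * fps_nth F n = fps_nth (fps_X * fps_deriv (fps_deriv F) + fps_deriv F) m"
      unfolding Suc by (cases m) (auto simp: algebra_simps power2_eq_square)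
    also have "\<dots> = (\<Sum>i=0..m. fps_nth Q i * fps_nth (fps_deriv F) (m - i))"
      unfolding ode fps_mult_nth ..
    also have "\<dots> = (\<Sum>i<n. fps_nth Q i * (of_nat (n - i) * fps_nth F (n - i)))"
      unfolding Suc by (intro sum.cong) (auto simp: Suc_diff_le)
    finally show ?thesis .
  qed simp
  have p0: "p 0 = 1" by (simp add: p_def)
  have Re: "Re (p z) \<ge> 0" if "z \<in> ball 0 1" for z
    unfolding p_def by (rule Re_convexity_quotient_nonneg[OF hol inj conv that])
  note bounds = Caratheodory_coeff_bounds[OF p p0 Re fps_nth_fps_expansion[OF Q]]
  show ?thesis
    by (rule that[of "fps_nth Q"])
       (use rec bounds p0 fps_nth_fps_expansion[OF Q, of 0] in \<open>auto simp: taylor_coeff_def F_def\<close>)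
qed

text \<open>Moving the term i = 0, which equals n a_n, to the left leaves n (n - 1) a_n as a sum
  over earlier coefficients. By induction and |P_i| <= 2 that sum is at most 2 (1 + ... + (n - 1)) =
  n (n - 1), so the factor cancels exactly.\<close>

lemma norm_class_C_coeff_le:
  assumes "f \<in> class_C"
  shows "cmod (taylor_coeff f n) \<le> 1"
proof -
  obtain P where rec: "\<And>n. (of_nat n)\<^sup>2 * taylor_coeff f n =
      (\<Sum>i<n. P i * (of_nat (n - i) * taylor_coeff f (n - i)))"
    and P: "P 0 = 1" "\<And>n. n > 0 \<Longrightarrow> cmod (P n) \<le> 2"
    by (rule class_C_Caratheodory_coeffs[OF assms]) blast
  have init: "taylor_coeff f 0 = 0" "taylor_coeff f 1 = 1"
    using assms by (auto simp: class_C_def class_S_def class_A_def)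
  show ?thesis
  proof (induction n rule: less_induct)
    case (less n)
    show ?case
    proof (cases "n < 2")
      case True
      thus ?thesis using init by (auto simp: less_2_cases_iff)
    next
      case False
      have "(of_nat n)\<^sup>2 * taylor_coeff f n = of_nat n * taylor_coeff f n +
          (\<Sum>i=1..<n. P i * (of_nat (n - i) * taylor_coeff f (n - i)))"
        using rec[of n] False P(1) by (simp add: lessThan_atLeast0 sum.atLeast_Suc_lessThan)
      hence eq: "of_nat n * of_nat (n - 1) * taylor_coeff f n =
          (\<Sum>i=1..<n. P i * (of_nat (n - i) * taylor_coeff f (n - i)))"
        using False by (simp add: of_nat_diff algebra_simps power2_eq_square)
      have "real n * real (n - 1) * cmod (taylor_coeff f n) =
          cmod (of_nat n * of_nat (n - 1) * taylor_coeff f n)"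
        by (simp only: norm_mult norm_of_nat)
      also have "\<dots> \<le> (\<Sum>i=1..<n. 2 * real (n - i))"
        unfolding eq
      proof (rule sum_norm_le)
        fix i assume i: "i \<in> {1..<n}"
        have "cmod (P i) * (real (n - i) * cmod (taylor_coeff f (n - i))) \<le> 2 * (real (n - i) * 1)"
          using i P(2)[of i] less[of "n - i"] by (intro mult_mono) auto
        thus "cmod (P i * (of_nat (n - i) * taylor_coeff f (n - i))) \<le> 2 * real (n - i)"
          by (simp add: norm_mult)
      qed
      also have "\<dots> = (\<Sum>i=1..<n. 2 * real i)"
        by (rule sum.reindex_bij_witness[of _ "\<lambda>i. n - i" "\<lambda>i. n - i"]) auto
      also have "\<dots> = real n * real (n - 1)"
        by (induction n) (auto simp: algebra_simps of_nat_diff)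
      finally show ?thesis using False by (simp add: mult_le_cancel_left1)
    qed
  qed
qed

text \<open>Both functionals become polynomials in P_1, P_2, P_3, grouped so that Livingston's
  inequality absorbs the mixed terms. The remaining estimates add up exactly to the denominators: 2
  + 4 = 6 and 32 + 80 + 32 = 144.\<close>

lemma class_C_coeff_functionals:
  assumes "f \<in> class_C"
  defines "a \<equiv> taylor_coeff f"
  shows "cmod (a 3 - 2 * (a 2)\<^sup>2) \<le> 1" and "cmod (a 2 * a 4 - 2 * (a 3)\<^sup>2) \<le> 1"
proof -
  obtain P where rec: "\<And>n. (of_nat n)\<^sup>2 * a n = (\<Sum>i<n. P i * (of_nat (n - i) * a (n - i)))"
    and P: "P 0 = 1" "\<And>n. n > 0 \<Longrightarrow> cmod (P n) \<le> 2"
    and PP: "\<And>n k. n > 0 \<Longrightarrow> k > 0 \<Longrightarrow> cmod (P (n + k) - P n * P k) \<le> 2"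
    unfolding a_def by (rule class_C_Caratheodory_coeffs[OF assms(1)]) blast
  have a1: "a 1 = 1"
    using assms by (auto simp: class_C_def class_S_def class_A_def)
  have a2: "a 2 = P 1 / 2"
    using rec[of 2] P(1) a1 by (simp add: eval_nat_numeral field_simps)
  have a3: "a 3 = ((P 1)\<^sup>2 + P 2) / 6"
    using rec[of 3] P(1) a1 a2 by (simp add: eval_nat_numeral field_simps)
  have a4: "a 4 = (P 1 ^ 3 + 3 * P 1 * P 2 + 2 * P 3) / 24"
  proof -
    have "16 * a 4 = 4 * a 4 + 3 * P 1 * a 3 + 2 * P 2 * a 2 + P 3"
      using rec[of 4] P(1) a1 by (simp add: eval_nat_numeral algebra_simps)
    hence "a 4 = (3 * P 1 * a 3 + 2 * P 2 * a 2 + P 3) / 12" by (simp add: field_simps)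
    also have "\<dots> = (P 1 ^ 3 + 3 * P 1 * P 2 + 2 * P 3) / 24"
      unfolding a2 a3 by (simp add: field_simps power2_eq_square power3_eq_cube)
    finally show ?thesis .
  qed
  have p: "cmod (P 1) \<le> 2" "cmod (P 2) \<le> 2" using P(2) by auto
  have q: "cmod (P 2 - P 1 * P 1) \<le> 2" "cmod (P 3 - P 1 * P 2) \<le> 2"
    using PP[of 1 1] PP[of 1 2] by (simp_all add: numeral_2_eq_2 numeral_3_eq_3)
  have pw: "cmod (P 1) ^ 4 \<le> 2 ^ 4" "(cmod (P 1))\<^sup>2 \<le> 2\<^sup>2" "(cmod (P 2))\<^sup>2 \<le> 2\<^sup>2"
    by (rule power_mono[OF p(1) norm_ge_zero] power_mono[OF p(2) norm_ge_zero])+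
  have "a 3 - 2 * (a 2)\<^sup>2 = ((P 2 - P 1 * P 1) - (P 1)\<^sup>2) / 6"
    by (simp add: a2 a3 power2_eq_square field_simps)
  moreover have "cmod ((P 2 - P 1 * P 1) - (P 1)\<^sup>2) \<le> 6"
    using norm_triangle_ineq4[of "P 2 - P 1 * P 1" "(P 1)\<^sup>2"] q pw by (simp add: norm_power)
  ultimately show "cmod (a 3 - 2 * (a 2)\<^sup>2) \<le> 1" by (simp only: norm_divide) simp
  \<comment> \<open>The numerator is 6 P_1 P_3 - 7 P_1^2 P_2 - 5 P_1^4 - 8 P_2^2. Six of the seven
    copies of P_1^2 P_2 pair with 6 P_1 P_3 to form a Livingston difference, so |\<open>?y\<close>|
    <= 2 (12 + 4).\<close>
  let ?x = "5 * P 1 ^ 4" and ?y = "P 1 * (6 * (P 3 - P 1 * P 2) - P 1 * P 2)" and ?z = "8 * (P 2)\<^sup>2"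
  have eq: "a 2 * a 4 - 2 * (a 3)\<^sup>2 = (?y - ?x - ?z) / 144"
    by (simp add: a2 a3 a4 power2_eq_square power3_eq_cube power4_eq_xxxx field_simps)
  have "cmod (P 1 * P 2) \<le> 2 * 2"
    unfolding norm_mult using p by (intro mult_mono) auto
  moreover have "cmod (6 * (P 3 - P 1 * P 2)) \<le> 12"
    using q(2) by (simp only: norm_mult norm_numeral)
  ultimately have "cmod (6 * (P 3 - P 1 * P 2) - P 1 * P 2) \<le> 16"
    using norm_triangle_ineq4[of "6 * (P 3 - P 1 * P 2)" "P 1 * P 2"] by linarith
  hence "cmod ?y \<le> 2 * 16"
    unfolding norm_mult using p by (intro mult_mono) auto
  moreover have "cmod ?x \<le> 80" "cmod ?z \<le> 32"
    using pw by (simp_all add: norm_mult norm_power)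
  moreover have "cmod (?y - ?x - ?z) \<le> cmod ?y + cmod ?x + cmod ?z"
    by (meson norm_triangle_ineq4 add_right_mono order_trans)
  ultimately have "cmod (?y - ?x - ?z) \<le> 144" by linarith
  thus "cmod (a 2 * a 4 - 2 * (a 3)\<^sup>2) \<le> 1" unfolding eq by (simp add: norm_divide)
qed

section \<open>Determinant formulas and the extremal half-plane map\<close>

lemma toeplitz_det_2:
  "toeplitz_det 2 n f = (taylor_coeff f n)\<^sup>2 - (taylor_coeff f (n + 1))\<^sup>2"
proof -
  let ?A = "mat 2 2 (\<lambda>(i, j). taylor_coeff f (n + nat \<bar>int i - int j\<bar>))"
  have "det ?A = (\<Sum>i<2. ?A $$ (i, 0) * cofactor ?A i 0)"
    by (rule laplace_expansion_column) auto
  thus ?thesis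
    by (simp add: toeplitz_det_def cofactor_def mat_delete_def numeral_2_eq_2 det_single power2_eq_square)
qed

text \<open>The vector (1, 0, -1) is an eigenvector of the matrix with eigenvalue a - c, which
  explains the linear factor; the other factor is built from the functionals estimated
  above.\<close>

lemma toeplitz_det_3:
  fixes f n
  defines "a \<equiv> taylor_coeff f n" and "b \<equiv> taylor_coeff f (n + 1)" and "c \<equiv> taylor_coeff f (n + 2)"
  shows "toeplitz_det 3 n f = (a - c) * (a\<^sup>2 + a * c - 2 * b\<^sup>2)"
proof -
  have det2: "det A = A $$ (0,0) * A $$ (1,1) - A $$ (1,0) * A $$ (0,1)"
    if "A \<in> carrier_mat (Suc (Suc 0)) (Suc (Suc 0))" for A :: "complex mat"
    using laplace_expansion_column[OF that, of 0] that
    by (simp add: cofactor_def mat_delete_def det_single)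
  let ?A = "mat 3 3 (\<lambda>(i, j). taylor_coeff f (n + nat \<bar>int i - int j\<bar>))"
  have "toeplitz_det 3 n f = (\<Sum>i<3. ?A $$ (i, 0) * cofactor ?A i 0)"
    unfolding toeplitz_det_def by (rule laplace_expansion_column) auto
  also have "\<dots> = a * (a * a - b * b) - b * (b * a - b * c) + c * (b * b - a * c)"
    by (simp add: cofactor_def mat_delete_def numeral_3_eq_3 det2 a_def b_def c_def
        right_diff_distrib)
  also have "\<dots> = (a - c) * (a\<^sup>2 + a * c - 2 * b\<^sup>2)"
    by (simp add: power2_eq_square algebra_simps)
  finally show ?thesis .
qed

text \<open>This is a rotation of z / (1 - z). The rotation by i makes a_(n+1)^2 = - a_n^2 and
  a_(n+2) = - a_n for n > 0, so the triangle inequalities behind the determinant bounds become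
  equalities.\<close>

lemma half_plane_map_class_C:
  defines "f \<equiv> (\<lambda>z. z / (1 - \<i> * z))"
  shows "f \<in> class_C" and "n > 0 \<Longrightarrow> taylor_coeff f n = \<i> ^ (n - 1)"
proof -
  have nz: "1 - \<i> * z \<noteq> 0" if "cmod z < 1" for z
  proof
    assume "1 - \<i> * z = 0"
    hence "cmod (\<i> * z) = cmod 1" by simp
    thus False using that by (simp add: norm_mult)
  qed
  define F where "F = Abs_fps (\<lambda>n. if n = 0 then 0 else \<i> ^ (n - 1))"
  have "f has_fps_expansion F"
  proof (rule has_fps_expansionI)
    have "(\<lambda>n. fps_nth F n * z ^ n) sums f z" if "z \<in> ball 0 1" for z
    proof -
      have "(\<lambda>n. z * (\<i> * z) ^ n) sums (z * (1 / (1 - \<i> * z)))"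
        using that by (intro sums_mult geometric_sums) (simp add: norm_mult)
      hence "(\<lambda>n. fps_nth F (Suc n) * z ^ Suc n) sums f z"
        by (simp add: F_def f_def power_mult_distrib mult_ac)
      thus ?thesis by (subst (asm) sums_Suc_iff) (simp add: F_def)
    qed
    thus "eventually (\<lambda>z. (\<lambda>n. fps_nth F n * z ^ n) sums f z) (nhds 0)"
      by (intro eventually_mono[OF eventually_nhds_in_open[of "ball 0 1"]]) auto
  qed
  hence coeff: "taylor_coeff f n = (if n = 0 then 0 else \<i> ^ (n - 1))" for n
    by (simp add: taylor_coeff_def fps_expansion_eqI F_def)
  show "taylor_coeff f n = \<i> ^ (n - 1)" if "n > 0" using that by (simp add: coeff)
  have "f holomorphic_on ball 0 1"
    unfolding f_def using nz by (intro holomorphic_intros) auto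
  moreover have "inj_on f (ball 0 1)"
    unfolding f_def using nz by (intro inj_onI) (auto simp: field_simps)
  moreover have "f ` ball 0 1 = {w. Im w < 1 / 2}"
  proof (intro equalityI subsetI)
    \<comment> \<open>The inverse map is w / (1 + i w), which lies in the disc exactly when |w| < |1
      + i w|; this identity turns that condition into Im w < 1/2.\<close>
    have *: "(cmod (1 + \<i> * w))\<^sup>2 - (cmod w)\<^sup>2 = 1 - 2 * Im w" for w
      unfolding cmod_power2 by (simp add: power2_eq_square algebra_simps)
    show "w \<in> {w. Im w < 1 / 2}" if w: "w \<in> f ` ball 0 1" for w
    proof -
      obtain z where z: "cmod z < 1" "w = f z" using w by auto
      have "1 + \<i> * w = 1 / (1 - \<i> * z)" using nz[OF z(1)] by (simp add: z f_def field_simps)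
      hence "cmod w < cmod (1 + \<i> * w)"
        using z nz[OF z(1)] by (simp add: z f_def norm_divide divide_strict_right_mono)
      hence "(cmod w)\<^sup>2 < (cmod (1 + \<i> * w))\<^sup>2" by (intro power_strict_mono) auto
      thus ?thesis using *[of w] by simp
    qed
    show "w \<in> f ` ball 0 1" if "w \<in> {w. Im w < 1 / 2}" for w
    proof -
      have "(cmod w)\<^sup>2 < (cmod (1 + \<i> * w))\<^sup>2" using *[of w] that by simp
      hence less: "cmod w < cmod (1 + \<i> * w)" by (rule power_less_imp_less_base) simp
      hence nz': "1 + \<i> * w \<noteq> 0" by (metis norm_ge_zero norm_zero not_less)
      have "w = f (w / (1 + \<i> * w))" using nz' by (simp add: f_def field_simps)
      moreover have "w / (1 + \<i> * w) \<in> ball 0 1" using less by (auto simp: norm_divide divide_less_eq_1)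
      ultimately show ?thesis by blast
    qed
  qed
  ultimately show "f \<in> class_C"
    using convex_halfspace_Im_lt[of "1 / 2"]
    by (simp add: class_C_def class_S_def class_A_def coeff)
qed

section \<open>Assembly of the determinant bounds and their sharpness\<close>

theorem theorem2p4:
  shows "(\<forall>f\<in>class_C.
            (\<forall>n\<ge>2. cmod (toeplitz_det 2 n f) \<le> 2) \<and>
            cmod (toeplitz_det 3 1 f) \<le> 4 \<and>
            cmod (toeplitz_det 3 2 f) \<le> 4) \<and>
         (\<forall>n\<ge>2. \<exists>f\<in>class_C. cmod (toeplitz_det 2 n f) = 2) \<and>
         (\<exists>f\<in>class_C. cmod (toeplitz_det 3 1 f) = 4) \<and>
         (\<exists>f\<in>class_C. cmod (toeplitz_det 3 2 f) = 4)"
proof (intro conjI ballI allI impI)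
  fix f assume f: "f \<in> class_C"
  define a where "a = taylor_coeff f"
  have a: "cmod (a n) \<le> 1" for n
    unfolding a_def by (rule norm_class_C_coeff_le[OF f])
  have a_sq: "cmod ((a n)\<^sup>2) \<le> 1" for n
    using a by (simp add: norm_power power_le_one)
  have a_diff: "cmod (a m - a n) \<le> 2" for m n
    using norm_triangle_ineq4[of "a m" "a n"] a[of m] a[of n] by linarith
  have a1: "a 1 = 1" using f by (simp add: a_def class_C_def class_S_def class_A_def)
  have fun1: "cmod (a 3 - 2 * (a 2)\<^sup>2) \<le> 1" and fun2: "cmod (a 2 * a 4 - 2 * (a 3)\<^sup>2) \<le> 1"
    unfolding a_def by (rule class_C_coeff_functionals[OF f])+
  show "cmod (toeplitz_det 2 n f) \<le> 2" for n
    using norm_triangle_ineq4[of "(a n)\<^sup>2" "(a (n + 1))\<^sup>2"] a_sq[of n] a_sq[of "n + 1"]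
    unfolding toeplitz_det_2 a_def by linarith
  \<comment> \<open>Here and for \<open>toeplitz_det 3 2 f\<close> the quadratic factor is a_n^2
    plus one of the two functionals, so each of the two factors has modulus at most 2.\<close>
  have "toeplitz_det 3 1 f = (a 1 - a 3) * (1 + (a 3 - 2 * (a 2)\<^sup>2))"
    using a1 toeplitz_det_3[of 1 f] by (simp add: a_def numeral_2_eq_2[symmetric] del: One_nat_def)
  moreover have "cmod (1 + (a 3 - 2 * (a 2)\<^sup>2)) \<le> 2"
    using norm_triangle_ineq[of 1 "a 3 - 2 * (a 2)\<^sup>2"] fun1 by simp
  ultimately show "cmod (toeplitz_det 3 1 f) \<le> 4"
    using mult_mono[OF a_diff[of 1 3], of "cmod (1 + (a 3 - 2 * (a 2)\<^sup>2))" 2]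
    by (simp add: norm_mult)
  have "toeplitz_det 3 2 f = (a 2 - a 4) * ((a 2)\<^sup>2 + (a 2 * a 4 - 2 * (a 3)\<^sup>2))"
    by (simp add: toeplitz_det_3 a_def)
  moreover have "cmod ((a 2)\<^sup>2 + (a 2 * a 4 - 2 * (a 3)\<^sup>2)) \<le> 2"
    using norm_triangle_ineq[of "(a 2)\<^sup>2" "a 2 * a 4 - 2 * (a 3)\<^sup>2"] fun2 a_sq[of 2] by linarith
  ultimately show "cmod (toeplitz_det 3 2 f) \<le> 4"
    using mult_mono[OF a_diff[of 2 4], of "cmod ((a 2)\<^sup>2 + (a 2 * a 4 - 2 * (a 3)\<^sup>2))" 2]
    by (simp add: norm_mult)
next
  let ?f = "\<lambda>z. z / (1 - \<i> * z)"
  fix n :: nat assume n: "n \<ge> 2"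
  \<comment> \<open>Consecutive coefficients differ by the factor i, so the two squares in the
    determinant add up instead of cancelling.\<close>
  have "\<i> ^ n = \<i> * \<i> ^ (n - 1)" using n by (cases n) auto
  hence "toeplitz_det 2 n ?f = 2 * (\<i> ^ (n - 1))\<^sup>2"
    using n by (simp add: toeplitz_det_2 half_plane_map_class_C(2) power_mult_distrib)
  hence "cmod (toeplitz_det 2 n ?f) = 2" by (simp add: norm_mult norm_power)
  thus "\<exists>f\<in>class_C. cmod (toeplitz_det 2 n f) = 2"
    using half_plane_map_class_C(1) by blast
next
  let ?f = "\<lambda>z. z / (1 - \<i> * z)"
  have "toeplitz_det 3 1 ?f = 4"
    by (simp add: toeplitz_det_3 half_plane_map_class_C(2))
  thus "\<exists>f\<in>class_C. cmod (toeplitz_det 3 1 f) = 4"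
    by (intro bexI[OF _ half_plane_map_class_C(1)]) simp
next
  let ?f = "\<lambda>z. z / (1 - \<i> * z)"
  \<comment> \<open>The coefficients i, -1, -i give the factors 2i and -2.\<close>
  have "toeplitz_det 3 2 ?f = - (4 * \<i>)"
    by (simp add: toeplitz_det_3 half_plane_map_class_C(2) power3_eq_cube)
  thus "\<exists>f\<in>class_C. cmod (toeplitz_det 3 2 f) = 4"
    by (intro bexI[OF _ half_plane_map_class_C(1)]) (simp add: norm_mult)
qed

end
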